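(* Let $j \geq 3$ be an integer and let $k_j = \min\{i : D(F_i) = j\}$, where $F_i$ denotes the friendship graph with $i$ triangles and $i \ge 2$. Then $\rho_j(F_{k_j+i}) = i + 1$ for every integer $i$ with $0 \leq i \leq j - 2$.
   Context: Graphs are finite and simple. For a graph $G$ with vertex set $V(G)$, a labeling $\phi : V(G) \to \{1,\ldots,r\}$ is $r$-distinguishing if for every non-trivial automorphism $\sigma \in \mathrm{Aut}(G)$ there is a vertex $x$ with $\phi(x) \neq \phi(\sigma x)$. The distinguishing number $D(G)$ is the least positive integer $r$ such that $G$ has an $r$-distinguishing labeling. If $D(G) = d$, the cost of $d$-distinguishing $G$, denoted $\rho_d(G)$, is the minimum size of a label class in any $d$-distinguishing labeling of $G$ (minimum over all such labelings and all $d$ label classes). The friendship graph $F_n$ ($n \geq 2$) is the graph obtained by joining $n$ copies of the cycle graph $C_3$ at one common vertex. It is known that $D(F_n) = \left\lceil \frac{1+\sqrt{8n+1}}{2} \right\rceil$ for $n \geq 2$; consequently, for $j \ge 3$, $k_j = \left\lfloor \frac{j^2-3j+2}{2} \right\rfloor + 1$ and $D(F_{k_j+i}) = j$ for all $0 \leq i \leq j-2$. *)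

theory Defs
  imports "Graph_Theory.Pair_Digraph"
begin

text \<open>
  A finite simple graph is a \<^locale>\<open>pair_graph\<close>: a finite, loop-free, symmetric digraph whose
  arcs are pairs of vertices, so an edge \<open>uv\<close> is represented by the two arcs \<open>(u, v)\<close>
  and \<open>(v, u)\<close>.
\<close>

definition automorphism :: "'a pair_pre_digraph \<Rightarrow> ('a \<Rightarrow> 'a) \<Rightarrow> bool" where
  "automorphism G \<sigma> \<longleftrightarrow>
     bij_betw \<sigma> (pverts G) (pverts G) \<and>
     (\<forall>u\<in>pverts G. \<forall>v\<in>pverts G. (\<sigma> u, \<sigma> v) \<in> parcs G \<longleftrightarrow> (u, v) \<in> parcs G)"

text \<open>
  Automorphisms are total functions whose values outside the vertex set are irrelevant; hence
  non-triviality is also tested on vertices only.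
\<close>

definition distinguishing :: "'a pair_pre_digraph \<Rightarrow> nat \<Rightarrow> ('a \<Rightarrow> nat) \<Rightarrow> bool" where
  "distinguishing G r \<phi> \<longleftrightarrow>
     \<phi> ` pverts G \<subseteq> {1..r} \<and>
     (\<forall>\<sigma>. automorphism G \<sigma> \<and> (\<exists>x\<in>pverts G. \<sigma> x \<noteq> x) \<longrightarrow>
          (\<exists>x\<in>pverts G. \<phi> x \<noteq> \<phi> (\<sigma> x)))"

definition distinguishing_number :: "'a pair_pre_digraph \<Rightarrow> nat" where
  "distinguishing_number G = (LEAST r. 0 < r \<and> (\<exists>\<phi>. distinguishing G r \<phi>))"

text \<open>
  The cost \<open>\<rho>\<^sub>d(G)\<close> only makes sense if \<open>D(G) = d\<close>; it is left unspecified otherwise.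
  In particular, proving a concrete value for it requires proving \<open>D(G) = d\<close>.
  Surjectivity of \<open>\<phi>\<close> need not be imposed: if \<open>d > 1\<close>, an unused label could be dropped,
  giving a \<open>(d - 1)\<close>-distinguishing labeling.
\<close>

definition distinguishing_cost :: "nat \<Rightarrow> 'a pair_pre_digraph \<Rightarrow> nat" where
  "distinguishing_cost d G =
     (if distinguishing_number G = d
      then LEAST m. \<exists>\<phi>. \<exists>c\<in>{1..d}.
             distinguishing G d \<phi> \<and> m = card {x \<in> pverts G. \<phi> x = c}
      else undefined)"

text \<open>The \<open>t\<close>-th copy of \<open>C\<^sub>3\<close> consists of the common vertex and two private ones.\<close>

datatype friendship_vertex = Hub | Rim nat bool

definition triangle :: "nat \<Rightarrow> friendship_vertex set" where
  "triangle t = {Hub, Rim t False, Rim t True}"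

definition friendship_graph :: "nat \<Rightarrow> friendship_vertex pair_pre_digraph" where
  "friendship_graph n =
     \<lparr> pverts = insert Hub (\<Union>t<n. triangle t),
       parcs = {(u, v). u \<noteq> v \<and> (\<exists>t<n. u \<in> triangle t \<and> v \<in> triangle t)} \<rparr>"

lemma pair_graph_friendship_graph: "pair_graph (friendship_graph n)"
proof -
  have fin: "finite (pverts (friendship_graph n))"
    by (simp add: friendship_graph_def triangle_def)
  have wf: "parcs (friendship_graph n) \<subseteq> pverts (friendship_graph n) \<times> pverts (friendship_graph n)"
    by (auto simp: friendship_graph_def)
  have fin_arcs: "finite (parcs (friendship_graph n))"
    using finite_subset[OF wf] fin by simp
  show ?thesis
  proof
    show "symmetric (with_proj (friendship_graph n))"
      by (auto simp: symmetric_def friendship_graph_def arcs_ends_conv intro!: symI)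
  qed (use wf fin fin_arcs in \<open>auto simp: friendship_graph_def\<close>)
qed

definition friendship_threshold :: "nat \<Rightarrow> nat" where
  "friendship_threshold j =
     (LEAST n. 2 \<le> n \<and> distinguishing_number (friendship_graph n) = j)"

end

theory Submission
  imports Defs
begin

text \<open>
  Labelling the friendship graph with \<open>r\<close> labels assigns to every triangle the pair of labels of
  its two private vertices. For \<open>n \<ge> 2\<close> the hub is the only vertex adjacent to all others, so
  every automorphism fixes it and permutes the triangles, possibly flipping some of them.
  Consequently a labelling is distinguishing iff no triangle has two equal private labels and no
  two triangles carry the same pair (lemma \<open>distinguishing_friendship_iff\<close>): up to flips, a
  distinguishing labelling is a choice of \<open>n\<close> distinct edges of the complete graph on the label
  set \<open>{1..r}\<close>, together with an arbitrary label for the hub.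

  Everything else is counting edges of complete graphs. A distinguishing labelling with \<open>r\<close> labels
  exists iff \<open>n \<le> r choose 2\<close>, hence \<open>D(F\<^sub>n) = j\<close> iff
  \<open>(j - 1) choose 2 < n \<le> j choose 2\<close>, and for \<open>j \<ge> 3\<close> the threshold is \<open>((j - 1) choose 2) + 1\<close>.
  Now take \<open>n = ((j - 1) choose 2) + 1 + i\<close>. Apart from the hub, the class of a label \<open>c\<close>
  has as many members as there are chosen edges incident with \<open>c\<close>
  (lemma \<open>card_rim_label_class\<close>). At most \<open>(j - 1) choose 2\<close> edges avoid \<open>c\<close>, so at least
  \<open>i + 1\<close> are incident with it, which bounds the cost from below. The bound is attained by choosing
  all edges that avoid the label \<open>j\<close> together with \<open>i + 1 \<le> j - 1\<close> edges at \<open>j\<close>, and giving the hub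
  a label other than \<open>j\<close>.
\<close>

section \<open>Automorphisms of friendship graphs\<close>

lemma pverts_friendship: "pverts (friendship_graph n) = insert Hub {Rim t b |t b. t < n}"
proof -
  have "Rim t b \<in> triangle s \<longleftrightarrow> s = t" for s t b
    by (cases b) (auto simp: triangle_def)
  then show ?thesis
    by (auto simp: friendship_graph_def triangle_def)
qed

lemma Hub_in_pverts [simp]: "Hub \<in> pverts (friendship_graph n)"
  by (simp add: pverts_friendship)

lemma Rim_in_pverts [simp]: "Rim t b \<in> pverts (friendship_graph n) \<longleftrightarrow> t < n"
  by (simp add: pverts_friendship)

lemma finite_pverts_friendship: "finite (pverts (friendship_graph n))"
  by (simp add: friendship_graph_def triangle_def)

lemma Hub_Rim_adjacent [simp]: "(Hub, Rim t b) \<in> parcs (friendship_graph n) \<longleftrightarrow> t < n"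
  by (cases b) (auto simp: friendship_graph_def triangle_def)

lemma Rim_Hub_adjacent [simp]: "(Rim t b, Hub) \<in> parcs (friendship_graph n) \<longleftrightarrow> t < n"
  by (cases b) (auto simp: friendship_graph_def triangle_def)

lemma Hub_Hub_not_adjacent [simp]: "(Hub, Hub) \<notin> parcs (friendship_graph n)"
  by (auto simp: friendship_graph_def)

lemma Rim_Rim_adjacent [simp]:
  "(Rim s b, Rim t c) \<in> parcs (friendship_graph n) \<longleftrightarrow> s = t \<and> t < n \<and> b \<noteq> c"
  by (cases b; cases c) (auto simp: friendship_graph_def triangle_def)

text \<open>
  Permutations of the triangles combined with flips: the symmetries that a labelling has to break.
  Disequality of Booleans serves as exclusive or, so \<open>f\<close> selects the triangles to be flipped.
\<close>

fun move_triangles :: "(nat \<Rightarrow> nat) \<Rightarrow> (nat \<Rightarrow> bool) \<Rightarrow> friendship_vertex \<Rightarrow> friendship_vertex" where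
  "move_triangles p f Hub = Hub"
| "move_triangles p f (Rim t b) = Rim (p t) (b \<noteq> f t)"

lemma automorphism_move_triangles:
  assumes p: "bij_betw p {..<n} {..<n}"
  shows "automorphism (friendship_graph n) (move_triangles p f)"
proof -
  have less: "p t < n" if "t < n" for t
    using p that by (auto dest: bij_betwE)
  have inj: "p s = p t \<longleftrightarrow> s = t" if "s < n" "t < n" for s t
    using p that by (auto simp: bij_betw_def inj_on_def)
  have "inj_on (move_triangles p f) (pverts (friendship_graph n))"
    by (auto simp: inj_on_def pverts_friendship inj)
  moreover have "move_triangles p f ` pverts (friendship_graph n) \<subseteq> pverts (friendship_graph n)"
    by (auto simp: pverts_friendship less)
  ultimately have "bij_betw (move_triangles p f)
      (pverts (friendship_graph n)) (pverts (friendship_graph n))"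
    by (simp add: bij_betw_def endo_inj_surj finite_pverts_friendship)
  then show ?thesis
    by (auto simp: automorphism_def pverts_friendship inj less)
qed

text \<open>
  With at least two triangles, a rim vertex misses the vertices of the other triangles, so
  adjacency to all other vertices singles out the hub.
\<close>

lemma automorphism_fixes_Hub:
  assumes "2 \<le> n" and aut: "automorphism (friendship_graph n) \<sigma>"
  shows "\<sigma> Hub = Hub"
proof (rule ccontr)
  let ?V = "pverts (friendship_graph n)"
  assume "\<sigma> Hub \<noteq> Hub"
  moreover have bij: "bij_betw \<sigma> ?V ?V"
    using aut by (simp add: automorphism_def)
  then have "\<sigma> Hub \<in> ?V"
    by (meson Hub_in_pverts bij_betwE)
  ultimately obtain s b where s: "\<sigma> Hub = Rim s b" "s < n"
    by (auto simp: pverts_friendship)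
  obtain t where t: "t < n" "t \<noteq> s"
  proof
    show "(if s = 0 then 1 else 0) < n" "(if s = 0 then 1 else 0) \<noteq> s"
      using \<open>2 \<le> n\<close> by auto
  qed
  have "Rim t True \<in> \<sigma> ` ?V"
    using bij t by (simp add: bij_betw_def)
  then obtain x where x: "x \<in> ?V" "\<sigma> x = Rim t True"
    by auto
  with s t have "x \<noteq> Hub"
    by auto
  with x have "(Hub, x) \<in> parcs (friendship_graph n)"
    by (auto simp: pverts_friendship)
  with aut x have "(\<sigma> Hub, \<sigma> x) \<in> parcs (friendship_graph n)"
    unfolding automorphism_def by (metis Hub_in_pverts)
  with s x t show False
    by simp
qed

text \<open>
  The two rim vertices of a triangle are adjacent, and so are their images, which are rim vertices
  because the hub is fixed; adjacent rim vertices lie in one triangle.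
\<close>

lemma automorphism_moves_triangles:
  assumes "2 \<le> n" and aut: "automorphism (friendship_graph n) \<sigma>" and "t < n"
  obtains s c where "s < n" "\<And>b. \<sigma> (Rim t b) = Rim s (b \<noteq> c)"
proof -
  let ?V = "pverts (friendship_graph n)"
  have bij: "bij_betw \<sigma> ?V ?V"
    using aut by (simp add: automorphism_def)
  have hub: "\<sigma> Hub = Hub"
    using assms automorphism_fixes_Hub by blast
  have rim: "\<exists>s c. \<sigma> (Rim t b) = Rim s c \<and> s < n" for b
  proof -
    have "\<sigma> (Rim t b) \<in> ?V"
      using bij \<open>t < n\<close> by (meson Rim_in_pverts bij_betwE)
    moreover have "\<sigma> (Rim t b) \<noteq> \<sigma> Hub"
      using inj_onD[OF bij_betw_imp_inj_on[OF bij], of "Rim t b" Hub] \<open>t < n\<close> by auto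
    ultimately show ?thesis
      using hub by (auto simp: pverts_friendship)
  qed
  obtain s c where F: "\<sigma> (Rim t False) = Rim s c" "s < n"
    using rim by blast
  obtain s' c' where T: "\<sigma> (Rim t True) = Rim s' c'"
    using rim by blast
  have "(\<sigma> (Rim t False), \<sigma> (Rim t True)) \<in> parcs (friendship_graph n)"
    using aut \<open>t < n\<close> by (simp add: automorphism_def)
  with F T have "s' = s" "c' = (\<not> c)"
    by auto
  with F T have "\<sigma> (Rim t b) = Rim s (b \<noteq> c)" for b
    by (cases b) auto
  with F that show thesis
    by blast
qed

section \<open>Distinguishing labellings as sets of edges of a complete graph\<close>

text \<open>The edge set of the complete graph on \<open>A\<close>.\<close>

definition two_subsets :: "'a set \<Rightarrow> 'a set set" where
  "two_subsets A = {S. S \<subseteq> A \<and> card S = 2}"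

lemma card_two_subsets: "finite A \<Longrightarrow> card (two_subsets A) = card A choose 2"
  by (simp add: two_subsets_def n_subsets)

lemma finite_two_subsets: "finite A \<Longrightarrow> finite (two_subsets A)"
  by (auto simp: two_subsets_def)

lemma doubleton_in_two_subsets: "{x, y} \<in> two_subsets A \<longleftrightarrow> x \<in> A \<and> y \<in> A \<and> x \<noteq> y"
  by (auto simp: two_subsets_def card_insert_if)

definition rim_labels :: "(friendship_vertex \<Rightarrow> 'a) \<Rightarrow> nat \<Rightarrow> 'a set" where
  "rim_labels \<phi> t = {\<phi> (Rim t False), \<phi> (Rim t True)}"

text \<open>
  Equal labels inside a triangle are preserved by flipping it, and two triangles with the same
  label pair can be exchanged, with a flip if the labels occur in opposite order. Conversely, an
  automorphism preserving all labels can only move a triangle to one with the same label pair.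
\<close>

lemma distinguishing_friendship_iff:
  assumes "2 \<le> n"
  shows "distinguishing (friendship_graph n) r \<phi> \<longleftrightarrow>
    \<phi> Hub \<in> {1..r} \<and> rim_labels \<phi> ` {..<n} \<subseteq> two_subsets {1..r} \<and> inj_on (rim_labels \<phi>) {..<n}"
    (is "?dist \<longleftrightarrow> ?hub \<and> ?edges \<and> ?inj")
proof
  assume dist: ?dist
  then have range: "\<phi> Hub \<in> {1..r}" "\<And>t b. t < n \<Longrightarrow> \<phi> (Rim t b) \<in> {1..r}"
    by (auto simp: distinguishing_def image_subset_iff pverts_friendship)
  \<comment> \<open>The only label-preserving permutation of the triangles with flips is the identity.\<close>
  have trivial: "p t = t \<and> \<not> f t"
    if p: "bij_betw p {..<n} {..<n}" and t: "t < n"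
      and preserve: "\<And>u b. u < n \<Longrightarrow> \<phi> (Rim (p u) (b \<noteq> f u)) = \<phi> (Rim u b)" for p f t
  proof (rule ccontr)
    assume nontrivial: "\<not> (p t = t \<and> \<not> f t)"
    have "move_triangles p f (Rim t True) \<noteq> Rim t True"
      using nontrivial by auto
    then have "\<exists>x\<in>pverts (friendship_graph n). move_triangles p f x \<noteq> x"
      using t by (meson Rim_in_pverts)
    with dist automorphism_move_triangles[OF p, of f]
    obtain x where "x \<in> pverts (friendship_graph n)" "\<phi> x \<noteq> \<phi> (move_triangles p f x)"
      unfolding distinguishing_def by blast
    with preserve show False
      by (auto simp: pverts_friendship)
  qed
  have differ: "\<phi> (Rim t False) \<noteq> \<phi> (Rim t True)" if "t < n" for t
  proof
    assume eq: "\<phi> (Rim t False) = \<phi> (Rim t True)"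
    have "\<phi> (Rim (id u) (b \<noteq> (u = t))) = \<phi> (Rim u b)" for u b
      using eq by (cases b; cases "u = t") auto
    with trivial[of id t "\<lambda>u. u = t"] that show False
      by simp
  qed
  have ?inj
  proof (rule inj_onI)
    fix s t
    assume less: "s \<in> {..<n}" "t \<in> {..<n}" and eq: "rim_labels \<phi> s = rim_labels \<phi> t"
    from eq obtain flip where flip: "\<And>b. \<phi> (Rim t (b \<noteq> flip)) = \<phi> (Rim s b)"
    proof -
      have "(\<forall>b. \<phi> (Rim t (b \<noteq> False)) = \<phi> (Rim s b)) \<or> (\<forall>b. \<phi> (Rim t (b \<noteq> True)) = \<phi> (Rim s b))"
        using eq by (auto simp: rim_labels_def doubleton_eq_iff all_bool_eq)
      then show thesis
        using that by blast
    qed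
    have flip': "\<phi> (Rim s (b \<noteq> flip)) = \<phi> (Rim t b)" for b
      using flip[of "b \<noteq> flip"] by (cases b; cases flip) auto
    let ?p = "id(s := t, t := s)"
    have "bij_betw ?p {..<n} {..<n}"
      using less by (auto intro!: bij_betwI[where g = ?p])
    moreover have "\<phi> (Rim (?p u) (b \<noteq> (flip \<and> u \<in> {s, t}))) = \<phi> (Rim u b)" for u b
      using flip flip' by (cases "u \<in> {s, t}") auto
    ultimately have "?p s = s"
      using less trivial[of ?p s "\<lambda>u. flip \<and> u \<in> {s, t}"] by blast
    then show "s = t"
      by (auto split: if_splits)
  qed
  moreover have ?edges
    using range differ by (auto simp: rim_labels_def doubleton_in_two_subsets)
  ultimately show "?hub \<and> ?edges \<and> ?inj"
    using range by blast
next
  assume labels: "?hub \<and> ?edges \<and> ?inj"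
  have differ: "\<phi> (Rim t False) \<noteq> \<phi> (Rim t True)"
    and rim_range: "\<phi> (Rim t b) \<in> {1..r}" if "t < n" for t b
  proof -
    have "rim_labels \<phi> t \<in> two_subsets {1..r}"
      using labels that by blast
    then have edge: "\<phi> (Rim t False) \<in> {1..r}" "\<phi> (Rim t True) \<in> {1..r}"
      "\<phi> (Rim t False) \<noteq> \<phi> (Rim t True)"
      unfolding rim_labels_def doubleton_in_two_subsets by blast+
    then show "\<phi> (Rim t False) \<noteq> \<phi> (Rim t True)"
      by blast
    show "\<phi> (Rim t b) \<in> {1..r}"
      using edge by (cases b) simp_all
  qed
  have "\<exists>x\<in>pverts (friendship_graph n). \<phi> x \<noteq> \<phi> (\<sigma> x)"
    if aut: "automorphism (friendship_graph n) \<sigma>"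
      and moved: "x \<in> pverts (friendship_graph n)" "\<sigma> x \<noteq> x" for \<sigma> x
  proof (rule ccontr)
    assume "\<not> ?thesis"
    then have preserve: "\<phi> (\<sigma> (Rim t b)) = \<phi> (Rim t b)" if "t < n" for t b
      using that by (metis Rim_in_pverts)
    have "x \<noteq> Hub"
      using moved automorphism_fixes_Hub[OF \<open>2 \<le> n\<close> aut] by blast
    with moved obtain t b where x: "x = Rim t b" "t < n"
      by (auto simp: pverts_friendship)
    obtain s c where s: "s < n" "\<And>b. \<sigma> (Rim t b) = Rim s (b \<noteq> c)"
      using automorphism_moves_triangles[OF \<open>2 \<le> n\<close> aut \<open>t < n\<close>] by blast
    have *: "\<phi> (Rim s (b \<noteq> c)) = \<phi> (Rim t b)" for b
      using preserve[OF \<open>t < n\<close>] s by metis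
    from *[of True] *[of False] have "rim_labels \<phi> s = rim_labels \<phi> t"
      by (cases c) (auto simp: rim_labels_def)
    with labels s x have "s = t"
      by (auto simp: inj_on_def)
    with *[of True] differ[OF \<open>t < n\<close>] have "\<not> c"
      by auto
    with moved x s \<open>s = t\<close> show False
      by simp
  qed
  moreover have "\<phi> ` pverts (friendship_graph n) \<subseteq> {1..r}"
    using labels rim_range unfolding pverts_friendship by blast
  ultimately show ?dist
    unfolding distinguishing_def by blast
qed

text \<open>
  Only the unordered label pairs matter, so the two labels of an edge may be distributed over the
  rim vertices of its triangle in either way: here the smaller label goes to \<open>False\<close>.
\<close>

lemma distinguishing_friendship_from_edges:
  assumes "2 \<le> n" and "E \<subseteq> two_subsets {1..r}" and "card E = n" and "h \<in> {1..r}"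
  obtains \<phi> where "distinguishing (friendship_graph n) r \<phi>" "\<phi> Hub = h"
    "bij_betw (rim_labels \<phi>) {..<n} E"
proof -
  have "finite E"
    using assms by (metis card.infinite not_numeral_le_zero)
  then obtain e where e: "bij_betw e {..<n} E"
    using assms(3) ex_bij_betw_nat_finite by (metis atLeast0LessThan)
  define \<phi> where "\<phi> v = (case v of Hub \<Rightarrow> h | Rim t b \<Rightarrow> if b then Max (e t) else Min (e t))" for v
  have labels: "rim_labels \<phi> t = e t" if "t < n" for t
  proof -
    have "e t \<in> E"
      using e that by (auto dest: bij_betwE)
    then obtain x y where "e t = {x, y}" "x \<noteq> y"
      using assms(2) by (auto simp: two_subsets_def card_2_iff)
    then show ?thesis
      by (auto simp: rim_labels_def \<phi>_def min_def max_def)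
  qed
  with e have bij: "bij_betw (rim_labels \<phi>) {..<n} E"
    by (subst bij_betw_cong[where g = e]) auto
  have "distinguishing (friendship_graph n) r \<phi>"
    using bij assms(2,4) unfolding distinguishing_friendship_iff[OF \<open>2 \<le> n\<close>]
    by (auto simp: bij_betw_def \<phi>_def)
  with bij show thesis
    by (intro that[of \<phi>]) (auto simp: \<phi>_def)
qed

section \<open>The distinguishing number\<close>

lemma distinguishing_friendship_exists_iff:
  assumes "2 \<le> n"
  shows "(\<exists>\<phi>. distinguishing (friendship_graph n) r \<phi>) \<longleftrightarrow> n \<le> r choose 2"
proof
  assume "\<exists>\<phi>. distinguishing (friendship_graph n) r \<phi>"
  then obtain \<phi> where "rim_labels \<phi> ` {..<n} \<subseteq> two_subsets {1..r}" "inj_on (rim_labels \<phi>) {..<n}"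
    using assms distinguishing_friendship_iff by blast
  then have "card {..<n} \<le> card (two_subsets {1..r})"
    by (intro card_inj_on_le) (auto simp: finite_two_subsets)
  then show "n \<le> r choose 2"
    by (simp add: card_two_subsets)
next
  assume le: "n \<le> r choose 2"
  then have "n \<le> card (two_subsets {1..r})"
    by (simp add: card_two_subsets)
  then obtain E where "E \<subseteq> two_subsets {1..r}" "card E = n"
    using obtain_subset_with_card_n by metis
  moreover have "1 \<in> {1..r}"
    using le assms by (cases r) (auto simp: binomial_eq_0)
  ultimately show "\<exists>\<phi>. distinguishing (friendship_graph n) r \<phi>"
    using distinguishing_friendship_from_edges[OF assms] by metis
qed

lemma distinguishing_number_friendship_eq_iff:
  assumes "2 \<le> n" and "0 < j"
  shows "distinguishing_number (friendship_graph n) = j \<longleftrightarrow>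
    (j - 1) choose 2 < n \<and> n \<le> j choose 2" (is "?D = j \<longleftrightarrow> _")
proof -
  have D: "?D = (LEAST r. n \<le> r choose 2)"
  proof -
    have "0 < r" if "n \<le> r choose 2" for r
      using that assms by (cases r) (auto simp: binomial_eq_0)
    then have "(\<lambda>r. 0 < r \<and> n \<le> r choose 2) = (\<lambda>r. n \<le> r choose 2)"
      by auto
    then show ?thesis
      by (simp add: distinguishing_number_def distinguishing_friendship_exists_iff[OF \<open>2 \<le> n\<close>])
  qed
  have "n \<le> (n + 1) choose 2"
    by (simp add: numeral_2_eq_2)
  then have attained: "n \<le> ?D choose 2"
    unfolding D by (rule LeastI)
  have minimal: "?D \<le> r" if "n \<le> r choose 2" for r
    unfolding D using that by (rule Least_le)
  have mono: "r choose 2 \<le> s choose 2" if "r \<le> s" for r s :: nat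
    using that by (rule binomial_right_mono)
  show ?thesis
  proof
    assume "?D = j"
    with attained minimal[of "j - 1"] \<open>0 < j\<close> show "(j - 1) choose 2 < n \<and> n \<le> j choose 2"
      by (metis diff_less leD less_numeral_extra(1) linorder_not_le)
  next
    assume j: "(j - 1) choose 2 < n \<and> n \<le> j choose 2"
    have "\<not> ?D \<le> j - 1"
      using j attained mono[of ?D "j - 1"] by linarith
    with minimal[of j] j show "?D = j"
      by linarith
  qed
qed

lemma choose_two_pred: "0 < j \<Longrightarrow> j choose 2 = ((j - 1) choose 2) + (j - 1)"
  by (cases j) (auto simp: numeral_2_eq_2)

lemma friendship_threshold_eq:
  assumes "3 \<le> j"
  shows "friendship_threshold j = ((j - 1) choose 2) + 1"
  unfolding friendship_threshold_def
proof (rule Least_equality)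
  have "2 choose 2 \<le> (j - 1) choose 2"
    using assms by (intro binomial_right_mono) simp
  then have two: "2 \<le> ((j - 1) choose 2) + 1"
    by simp
  moreover have "((j - 1) choose 2) + 1 \<le> j choose 2"
    using assms choose_two_pred[of j] by simp
  ultimately show "2 \<le> ((j - 1) choose 2) + 1 \<and>
      distinguishing_number (friendship_graph (((j - 1) choose 2) + 1)) = j"
    using assms by (simp add: distinguishing_number_friendship_eq_iff)
next
  fix n
  assume "2 \<le> n \<and> distinguishing_number (friendship_graph n) = j"
  then show "((j - 1) choose 2) + 1 \<le> n"
    using assms distinguishing_number_friendship_eq_iff[of n j] by simp
qed

section \<open>The cost\<close>

text \<open>
  Since the labels within a triangle differ, a triangle contributes one vertex to the class of each
  label in its pair.
\<close>

lemma card_rim_label_class: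
  assumes "2 \<le> n" and dist: "distinguishing (friendship_graph n) r \<phi>"
  shows "card {x \<in> pverts (friendship_graph n) - {Hub}. \<phi> x = c} =
    card {t \<in> {..<n}. c \<in> rim_labels \<phi> t}" (is "card ?X = card ?T")
proof -
  have differ: "\<phi> (Rim t False) \<noteq> \<phi> (Rim t True)" if "t < n" for t
    using dist that unfolding distinguishing_friendship_iff[OF \<open>2 \<le> n\<close>]
    by (auto simp: rim_labels_def image_subset_iff doubleton_in_two_subsets)
  define v where "v t = Rim t (\<phi> (Rim t True) = c)" for t
  have v: "\<phi> (Rim t b) = c \<longleftrightarrow> c \<in> rim_labels \<phi> t \<and> Rim t b = v t" if "t < n" for t b
    using differ[OF that] by (cases b) (auto simp: rim_labels_def v_def)
  have "x \<in> ?X \<longleftrightarrow> x \<in> v ` ?T" for x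
  proof (cases x)
    case Hub
    then show ?thesis
      by (auto simp: v_def)
  next
    case (Rim t b)
    then have "x \<in> ?X \<longleftrightarrow> t < n \<and> c \<in> rim_labels \<phi> t \<and> x = v t"
      using v[of t b] by auto
    also have "\<dots> \<longleftrightarrow> x \<in> v ` ?T"
      using Rim by (auto simp: v_def image_iff)
    finally show ?thesis .
  qed
  then have "?X = v ` ?T"
    by blast
  moreover have "inj_on v ?T"
    by (simp add: v_def inj_on_def)
  ultimately show ?thesis
    by (simp add: card_image)
qed

text \<open>
  Distinct triangles carry distinct edges, and only \<open>(j - 1) choose 2\<close> edges avoid a given label.
\<close>

lemma card_label_class_ge:
  assumes "2 \<le> n" and dist: "distinguishing (friendship_graph n) j \<phi>" and "c \<in> {1..j}"
  shows "n \<le> ((j - 1) choose 2) + card {x \<in> pverts (friendship_graph n). \<phi> x = c}"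
proof -
  let ?avoid = "{t \<in> {..<n}. c \<notin> rim_labels \<phi> t}" and ?meet = "{t \<in> {..<n}. c \<in> rim_labels \<phi> t}"
  have edges: "rim_labels \<phi> ` {..<n} \<subseteq> two_subsets {1..j}" "inj_on (rim_labels \<phi>) {..<n}"
    using dist distinguishing_friendship_iff[OF \<open>2 \<le> n\<close>] by blast+
  have "card ?avoid \<le> card (two_subsets ({1..j} - {c}))"
  proof (rule card_inj_on_le)
    show "inj_on (rim_labels \<phi>) ?avoid"
      using edges(2) by (rule inj_on_subset) auto
    show "rim_labels \<phi> ` ?avoid \<subseteq> two_subsets ({1..j} - {c})"
      using edges(1) by (auto simp: two_subsets_def image_subset_iff)
  qed (simp add: finite_two_subsets)
  also have "\<dots> = (j - 1) choose 2"
    using \<open>c \<in> {1..j}\<close> by (simp add: card_two_subsets)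
  finally have avoid: "card ?avoid \<le> (j - 1) choose 2" .
  have "card ?meet \<le> card {x \<in> pverts (friendship_graph n). \<phi> x = c}"
    unfolding card_rim_label_class[OF assms(1,2), symmetric]
    by (intro card_mono) (auto simp: finite_pverts_friendship)
  moreover have "n = card ?avoid + card ?meet"
  proof -
    have "{..<n} = ?avoid \<union> ?meet"
      by auto
    then have "card {..<n} = card (?avoid \<union> ?meet)"
      by presburger
    also have "\<dots> = card ?avoid + card ?meet"
      by (rule card_Un_disjoint) auto
    finally show ?thesis
      by simp
  qed
  ultimately show ?thesis
    using avoid by linarith
qed

text \<open>
  Taking all edges that avoid the label \<open>j\<close> leaves as few edges as possible to be incident with it.
\<close>

lemma distinguishing_friendship_small_class:
  assumes "2 \<le> n" and n: "n = ((j - 1) choose 2) + m" and "m \<le> j - 1"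
  obtains \<phi> where "distinguishing (friendship_graph n) j \<phi>"
    "card {x \<in> pverts (friendship_graph n). \<phi> x = j} = m"
proof -
  have "2 \<le> j"
  proof (rule ccontr)
    assume "\<not> 2 \<le> j"
    then have "j - 1 = 0"
      by simp
    with n \<open>m \<le> j - 1\<close> have "n = 0"
      by (simp add: binomial_eq_0)
    with \<open>2 \<le> n\<close> show False
      by simp
  qed
  let ?A = "two_subsets {1..j - 1}"
  have "m \<le> card {1..j - 1}"
    using \<open>m \<le> j - 1\<close> by simp
  then obtain M where M: "M \<subseteq> {1..j - 1}" "card M = m"
    by (rule obtain_subset_with_card_n)
  then have "finite M"
    using finite_subset by blast
  let ?B = "(\<lambda>s. {j, s}) ` M"
  have "j \<notin> M"
    using M \<open>2 \<le> j\<close> by auto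
  have "inj_on (\<lambda>s. {j, s}) M"
    by (auto simp: inj_on_def doubleton_eq_iff)
  then have cardB: "card ?B = m"
    using M by (simp add: card_image)
  have avoid: "j \<notin> S" if "S \<in> ?A" for S
    using that \<open>2 \<le> j\<close> by (auto simp: two_subsets_def)
  \<comment> \<open>All edges that avoid the label \<open>j\<close>, and \<open>m\<close> edges at \<open>j\<close>\<close>
  have "?A \<inter> ?B = {}"
    using avoid by blast
  then have "card (?A \<union> ?B) = card ?A + card ?B"
    using \<open>finite M\<close> by (intro card_Un_disjoint) (simp_all add: finite_two_subsets)
  then have card: "card (?A \<union> ?B) = n"
    by (simp add: cardB n card_two_subsets)
  have edges: "?A \<union> ?B \<subseteq> two_subsets {1..j}"
  proof -
    have "{1..j - 1} \<subseteq> {1..j}"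
      by simp
    then have "?A \<subseteq> two_subsets {1..j}"
      unfolding two_subsets_def by blast
    moreover have "?B \<subseteq> two_subsets {1..j}"
      using M(1) \<open>{1..j - 1} \<subseteq> {1..j}\<close> \<open>j \<notin> M\<close> \<open>2 \<le> j\<close>
      by (auto simp: doubleton_in_two_subsets subset_iff)
    ultimately show ?thesis
      by blast
  qed
  \<comment> \<open>Labelling the hub \<open>1 \<noteq> j\<close> keeps it out of the class of \<open>j\<close>.\<close>
  have "1 \<in> {1..j}"
    using \<open>2 \<le> j\<close> by simp
  with edges card obtain \<phi> where \<phi>: "distinguishing (friendship_graph n) j \<phi>" "\<phi> Hub = 1"
    "bij_betw (rim_labels \<phi>) {..<n} (?A \<union> ?B)"
    by (rule distinguishing_friendship_from_edges[OF \<open>2 \<le> n\<close>])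
  have "rim_labels \<phi> ` {t \<in> {..<n}. j \<in> rim_labels \<phi> t} = {S \<in> ?A \<union> ?B. j \<in> S}"
    unfolding bij_betw_imp_surj_on[OF \<phi>(3), symmetric] by blast
  also have "\<dots> = ?B"
    using avoid by auto
  finally have image: "rim_labels \<phi> ` {t \<in> {..<n}. j \<in> rim_labels \<phi> t} = ?B" .
  have "inj_on (rim_labels \<phi>) {t \<in> {..<n}. j \<in> rim_labels \<phi> t}"
    using bij_betw_imp_inj_on[OF \<phi>(3)] by (rule inj_on_subset) blast
  from card_image[OF this] image cardB have "card {t \<in> {..<n}. j \<in> rim_labels \<phi> t} = m"
    by simp
  moreover have "{x \<in> pverts (friendship_graph n) - {Hub}. \<phi> x = j} =
      {x \<in> pverts (friendship_graph n). \<phi> x = j}"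
    using \<phi>(2) \<open>2 \<le> j\<close> by auto
  ultimately show thesis
    using that \<phi>(1) card_rim_label_class[OF \<open>2 \<le> n\<close> \<phi>(1), of j] by simp
qed

theorem theorem2p10:
  fixes j i :: nat
  assumes "3 \<le> j" and "i \<le> j - 2"
  shows "distinguishing_cost j (friendship_graph (friendship_threshold j + i)) = i + 1"
proof -
  define n where "n = ((j - 1) choose 2) + (i + 1)"
  have n: "friendship_threshold j + i = n"
    using assms by (simp add: n_def friendship_threshold_eq)
  have "2 choose 2 \<le> (j - 1) choose 2"
    using assms by (intro binomial_right_mono) simp
  then have "2 \<le> n"
    by (simp add: n_def)
  have "(j - 1) choose 2 < n"
    by (simp add: n_def)
  moreover have "n \<le> j choose 2"
    using assms choose_two_pred[of j] unfolding n_def by linarith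
  ultimately have D: "distinguishing_number (friendship_graph n) = j"
    using distinguishing_number_friendship_eq_iff[of n j] \<open>2 \<le> n\<close> assms by simp
  have "(LEAST m. \<exists>\<phi>. \<exists>c\<in>{1..j}. distinguishing (friendship_graph n) j \<phi> \<and>
      m = card {x \<in> pverts (friendship_graph n). \<phi> x = c}) = i + 1"
  proof (rule Least_equality)
    have "i + 1 \<le> j - 1"
      using assms by simp
    with \<open>2 \<le> n\<close> n_def obtain \<phi> where "distinguishing (friendship_graph n) j \<phi>"
      "card {x \<in> pverts (friendship_graph n). \<phi> x = j} = i + 1"
      by (rule distinguishing_friendship_small_class)
    then show "\<exists>\<phi>. \<exists>c\<in>{1..j}. distinguishing (friendship_graph n) j \<phi> \<and>
        i + 1 = card {x \<in> pverts (friendship_graph n). \<phi> x = c}"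
      using assms by (intro exI[of _ \<phi>] bexI[of _ j]) simp_all
  next
    fix m
    assume "\<exists>\<phi>. \<exists>c\<in>{1..j}. distinguishing (friendship_graph n) j \<phi> \<and>
      m = card {x \<in> pverts (friendship_graph n). \<phi> x = c}"
    then obtain \<phi> c where \<phi>: "distinguishing (friendship_graph n) j \<phi>" and c: "c \<in> {1..j}"
      and m: "m = card {x \<in> pverts (friendship_graph n). \<phi> x = c}"
      by (elim exE bexE conjE)
    have "n \<le> ((j - 1) choose 2) + m"
      unfolding m using \<open>2 \<le> n\<close> \<phi> c by (rule card_label_class_ge)
    then show "i + 1 \<le> m"
      by (simp add: n_def)
  qed
  with D show ?thesis
    by (simp add: n distinguishing_cost_def)
qed

end
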